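(* Let $G$ be a finite simple graph on $n\ge 1$ vertices with clique number $\omega=\omega(G)$. Let $s^+(G)=\sum_{\lambda_i>0}\lambda_i^2$, where $\lambda_1\ge\cdots\ge\lambda_n$ are the eigenvalues (with multiplicity) of the adjacency matrix of $G$. Then $$\sqrt{s^{+}(G)}\le\left(1-\frac1\omega\right)n.$$
   Context: Graphs are finite and simple. The clique number $\omega(G)$ is the largest number of vertices in a clique (complete subgraph) of $G$. The quantity $s^+(G)$ is called the positive square energy of $G$: the sum of the squares of the positive eigenvalues of the $0/1$ adjacency matrix of $G$, counted with multiplicity. *)

theory Defs
  imports Complex_Main "HOL-Library.Ramsey" "Jordan_Normal_Form.Char_Poly"
begin

definition simple_graph :: "'a set \<Rightarrow> 'a set set \<Rightarrow> bool" where
  "simple_graph V E \<longleftrightarrow> finite V \<and> E \<subseteq> nsets V 2"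

definition clique_number :: "'a set \<Rightarrow> 'a set set \<Rightarrow> nat" where
  "clique_number V E = Max {card K |K. K \<subseteq> V \<and> clique K E}"

text \<open>
  The matrix is indexed by positions in an enumeration \<open>vs\<close> of the vertices without repetition;
  a different enumeration conjugates it by a permutation matrix. The diagonal vanishes
  for a simple graph, because the singleton \<open>{v, v}\<close> is not an edge.
\<close>

definition adjacency_matrix :: "'a list \<Rightarrow> 'a set set \<Rightarrow> real mat" where
  "adjacency_matrix vs E =
     mat (length vs) (length vs) (\<lambda>(i, j). if {vs ! i, vs ! j} \<in> E then 1 else 0)"

text \<open>
  Multiplicity is algebraic multiplicity. Only real eigenvalues are seen here; a symmetric
  matrix has no others.
\<close>

definition positive_square_energy :: "real mat \<Rightarrow> real" where
  "positive_square_energy A =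
     (\<Sum>\<mu> | eigenvalue A \<mu> \<and> \<mu> > 0. real (Polynomial.order \<mu> (char_poly A)) * \<mu>\<^sup>2)"

end

theory Submission
  imports Defs "Jordan_Normal_Form.Spectral_Radius" "HOL-Analysis.Function_Topology"
    "HOL-Analysis.Convex"
begin

text \<open>
  With \<open>X\<close> the positive part of the adjacency matrix \<open>A\<close>, both \<open>\<langle>A, X\<rangle>\<close> and \<open>\<parallel>X\<parallel>\<^sup>2\<close> equal the positive
  square energy, so it suffices to bound \<open>\<langle>A, Z\<rangle> \<le> (1 - 1/\<omega>) n \<parallel>Z\<parallel>\<close> for Gram matrices \<open>Z\<close>.
  Introduce vertex weights \<open>w\<^sub>u = y\<^sub>u\<^sup>2\<close> and let \<open>\<phi>\<close> be the maximum of
  \<open>\<Sum> A\<^sub>u\<^sub>v y\<^sub>u y\<^sub>v Z\<^sub>u\<^sub>v\<close> over unit vectors \<open>y\<close> and Gram matrices of norm 1. At a maximizer, stationarity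
  in \<open>y\<^sub>u\<close> and under rescaling of the \<open>u\<close>-th Gram vector gives \<open>\<Sum>\<^sub>v A\<^sub>u\<^sub>v Z\<^sub>u\<^sub>v y\<^sub>v = \<phi> y\<^sub>u\<close> and
  \<open>\<Sum>\<^sub>v Z\<^sub>u\<^sub>v\<^sup>2 = w\<^sub>u\<close>. Two applications of Cauchy-Schwarz then yield, for an independent set \<open>S\<close> of
  weight \<open>s\<close> and average weighted degree \<open>d\<close>, the inequality \<open>\<phi>\<^sup>2 \<le> d (1 - s)\<close>.

  Among the maximum cliques of the support choose \<open>K\<close> with the largest degree sum, and for \<open>i \<in> K\<close> let
  \<open>U\<^sub>i\<close> consist of the vertices whose only non-neighbour in \<open>K\<close> is \<open>i\<close>. Each \<open>U\<^sub>i\<close> is independent, and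
  its vertices have degree at most \<open>d\<^sub>i\<close>, since otherwise exchanging \<open>i\<close> would improve \<open>K\<close>. Hence
  \<open>2 \<phi> \<le> d\<^sub>i + 1 - w(U\<^sub>i)\<close>, while counting edges into \<open>K\<close> gives
  \<open>\<Sum> d\<^sub>i \<le> |K| - 2 + \<Sum> w(U\<^sub>i)\<close>. Summing over \<open>K\<close>, \<open>\<phi> \<le> 1 - 1/|K|\<close>.
\<close>

section \<open>A large clique from bounds on independent sets\<close>

definition wdegree :: "('a \<Rightarrow> real) \<Rightarrow> 'a set \<Rightarrow> 'a set set \<Rightarrow> 'a \<Rightarrow> real" where
  "wdegree w V E u = (\<Sum>v \<in> {v \<in> V. {u, v} \<in> E}. w v)"

lemma mult_le_half_sum_square: "a * b \<le> ((a + b) / 2)\<^sup>2" for a b :: real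
  using zero_le_power2[of "a - b"] by (simp add: power2_eq_square field_simps)

text \<open>An exchange argument on one extremal clique. The assumed inequality is \<phi>^2 \<le> d
  (1 - s), with d the average weighted degree on \<open>S\<close>, multiplied by s =
  \<open>sum w S\<close>.\<close>

lemma exists_clique_of_independent_set_bound:
  fixes w :: "'a \<Rightarrow> real"
  assumes V: "finite V" "V \<noteq> {}" and loopless: "\<And>u. {u} \<notin> E"
    and w: "\<And>u. u \<in> V \<Longrightarrow> w u > 0" "sum w V = 1"
    and indep: "\<And>S. \<lbrakk>S \<subseteq> V; indep S E\<rbrakk> \<Longrightarrow>
      \<phi>\<^sup>2 * sum w S \<le> (\<Sum>u\<in>S. w u * wdegree w V E u) * (1 - sum w S)"
  shows "\<exists>K \<subseteq> V. clique K E \<and> K \<noteq> {} \<and> \<phi> \<le> 1 - 1 / real (card K)"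
proof -
  define d where "d = wdegree w V E"
  define C where "C = {K. K \<subseteq> V \<and> clique K E}"
  have finC: "finite C"
    unfolding C_def using V(1) by (auto intro: finite_subset[of _ "Pow V"])
  have finK: "finite K" if "K \<in> C" for K
    using that V(1) by (auto simp: C_def intro: finite_subset)
  obtain v0 where "v0 \<in> V" using V(2) by auto
  hence C0: "{v0} \<in> C" by (auto simp: C_def clique_def)
  define M where "M = Max (card ` C)"
  define C' where "C' = {K \<in> C. card K = M}"
  have "M \<in> card ` C" unfolding M_def using finC C0 by (intro Max_in) auto
  hence "C' \<noteq> {}" "finite C'" using finC by (auto simp: C'_def)
  hence "Max (sum d ` C') \<in> sum d ` C'" by (intro Max_in) auto
  \<comment> \<open>Two extremality properties are used: maximum size makes each \<open>U i\<close>
    independent, and maximum degree sum bounds the degrees inside \<open>U i\<close>.\<close>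
  then obtain K where K: "K \<in> C'" and KM: "sum d K = Max (sum d ` C')" by auto
  have Kmax: "sum d K' \<le> sum d K" if "K' \<in> C'" for K'
    unfolding KM using \<open>finite C'\<close> that by (intro Max_ge) auto
  have cardmax: "card K' \<le> card K" if "K' \<in> C" for K'
    using that K finC by (auto simp: C'_def M_def)
  have KC: "K \<in> C" "K \<subseteq> V" "clique K E" "finite K"
    using K finK by (auto simp: C'_def C_def)
  have "card K \<ge> 1" using cardmax[OF C0] by simp
  hence Kne: "K \<noteq> {}" by auto
  have edge: "{i, j} \<in> E" if "i \<in> K" "j \<in> K" "i \<noteq> j" for i j
    using KC(3) that by (auto simp: clique_def)
  \<comment> \<open>The vertices that can replace \<open>i\<close> in \<open>K\<close> and still
    give a clique; \<open>i\<close> itself is one of them, as there are no loops.\<close>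
  define U where "U i = {u \<in> V. {u, i} \<notin> E \<and> (\<forall>j \<in> K - {i}. {u, j} \<in> E)}" for i
  have iU: "i \<in> U i" if "i \<in> K" for i
    using that KC(2) edge loopless[of i] by (auto simp: U_def)
  have swapC: "insert u (K - {i}) \<in> C" if "i \<in> K" "u \<in> U i" for i u
    using that KC edge by (auto simp: C_def clique_def U_def insert_commute)
  have disjU: "u \<notin> K - {i}" if "i \<in> K" "u \<in> U i" for i u
  proof
    assume "u \<in> K - {i}"
    hence "{u, u} \<in> E" using that(2) unfolding U_def by blast
    thus False using loopless[of u] by simp
  qed
  have indU: "indep (U i) E" if i: "i \<in> K" for i
    unfolding indep_def
  proof (intro ballI impI notI)
    fix u v assume u: "u \<in> U i" and v: "v \<in> U i" and uv: "u \<noteq> v" and e: "{u, v} \<in> E"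
    \<comment> \<open>Removing \<open>i\<close> and adding both ends of the edge would give a clique
      with one more vertex than \<open>K\<close>.\<close>
    have "insert v (insert u (K - {i})) \<in> C"
      using swapC[OF i u] swapC[OF i v] e uv by (auto simp: C_def clique_def insert_commute)
    hence "card (insert v (insert u (K - {i}))) \<le> card K" by (rule cardmax)
    moreover have "card (insert v (insert u (K - {i}))) = Suc (card K)"
      using disjU[OF i u] disjU[OF i v] uv KC(4) i \<open>card K \<ge> 1\<close> by (simp add: card_Diff_singleton)
    ultimately show False by simp
  qed
  have dU: "d u \<le> d i" if i: "i \<in> K" and u: "u \<in> U i" for i u
  proof -
    have "card (insert u (K - {i})) = card K"
      using disjU[OF i u] KC(4) i \<open>card K \<ge> 1\<close> by (simp add: card_Diff_singleton)
    hence "insert u (K - {i}) \<in> C'" using swapC[OF i u] K by (auto simp: C'_def)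
    from Kmax[OF this] have "d u + sum d (K - {i}) \<le> sum d K"
      using disjU[OF i u] KC(4) by simp
    thus ?thesis using sum.remove[OF KC(4) i, of d] by simp
  qed
  have d0: "d u \<ge> 0" for u
    unfolding d_def wdegree_def using w(1) by (intro sum_nonneg) (auto intro: less_imp_le)
  have finU: "finite (U i)" for i using V(1) by (auto simp: U_def)
  have main: "2 * \<phi> \<le> d i + 1 - sum w (U i)" if i: "i \<in> K" for i
  proof -
    let ?s = "sum w (U i)"
    have UV: "U i \<subseteq> V" by (auto simp: U_def)
    \<comment> \<open>Since \<open>i\<close> lies in \<open>U i\<close>, the weight is positive and
      can be cancelled below.\<close>
    have spos: "?s > 0" using w(1) UV iU[OF i] finU by (intro sum_pos) auto
    have s1: "?s \<le> 1" using sum_mono2[OF V(1) UV, of w] w by (auto intro: less_imp_le)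
    have "\<phi>\<^sup>2 * ?s \<le> (\<Sum>u\<in>U i. w u * d u) * (1 - ?s)"
      using indep[OF UV indU[OF i]] by (simp add: d_def)
    also have "\<dots> \<le> (\<Sum>u\<in>U i. w u * d i) * (1 - ?s)"
      using dU[OF i] w(1) UV s1
      by (intro mult_right_mono sum_mono mult_left_mono) (auto intro: less_imp_le)
    also have "\<dots> = (d i * (1 - ?s)) * ?s" by (subst sum_distrib_right[symmetric]) simp
    finally have "\<phi>\<^sup>2 \<le> d i * (1 - ?s)" using spos by simp
    \<comment> \<open>The arithmetic-geometric mean inequality makes the bound linear in
      \<open>d i\<close> and the weight, so that it can be summed over \<open>K\<close>.\<close>
    also have "\<dots> \<le> ((d i + (1 - ?s)) / 2)\<^sup>2"
      by (rule mult_le_half_sum_square)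
    finally have "\<phi> \<le> (d i + (1 - ?s)) / 2"
      by (rule power2_le_imp_le) (use d0[of i] s1 in simp)
    thus ?thesis by simp
  qed
  let ?n = "\<lambda>u. card {i \<in> K. {i, u} \<in> E}"
  \<comment> \<open>Maximality of \<open>K\<close> gives every vertex at least one non-neighbour in
    \<open>K\<close>, where a member of \<open>K\<close> counts as its own. With exactly one, say
    \<open>i\<close>, the vertex lies in \<open>U i\<close>; otherwise at most |K| - 2 neighbours
    remain.\<close>
  have count: "real (?n u) \<le> real (card K) - 2 + (\<Sum>i\<in>K. of_bool (u \<in> U i))" if u: "u \<in> V" for u
  proof -
    let ?T = "{i \<in> K. {i, u} \<notin> E}"
    have split: "card K = ?n u + card ?T"
      using KC(4) by (subst card_Un_disjoint[symmetric]) (auto intro: arg_cong[of _ _ card])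
    have "?T \<noteq> {}"
    proof
      assume T: "?T = {}"
      hence "u \<notin> K" using loopless[of u] by auto
      moreover have "insert u K \<in> C" using T KC u by (auto simp: C_def clique_def insert_commute)
      ultimately show False using cardmax[of "insert u K"] KC(4) by simp
    qed
    hence T1: "card ?T \<ge> 1" using KC(4) by (simp add: Suc_le_eq card_gt_0_iff)
    have nonneg: "(\<Sum>i\<in>K. of_bool (u \<in> U i) :: real) \<ge> 0" by (intro sum_nonneg) auto
    show ?thesis
    proof (cases "card ?T = 1")
      case True
      then obtain i where i: "?T = {i}" by (auto simp: card_1_singleton_iff)
      hence "i \<in> K" "u \<in> U i" using u by (auto simp: U_def insert_commute)
      hence "(\<Sum>i\<in>K. of_bool (u \<in> U i) :: real) \<ge> 1"
        using member_le_sum[of i K "\<lambda>i. of_bool (u \<in> U i) :: real"] KC(4) by auto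
      thus ?thesis using split True by simp
    next
      case False
      thus ?thesis using split T1 nonneg by simp
    qed
  qed
  \<comment> \<open>Double counting: the degree sum of \<open>K\<close> is the weighted number of
    neighbours that the vertices have in \<open>K\<close>.\<close>
  have "(\<Sum>i\<in>K. d i) = (\<Sum>i\<in>K. \<Sum>u\<in>V. w u * of_bool ({i, u} \<in> E))"
    unfolding d_def wdegree_def
    by (rule sum.cong[OF refl], rule sum.mono_neutral_cong_left) (use V(1) in auto)
  also have "\<dots> = (\<Sum>u\<in>V. w u * real (?n u))"
    by (subst sum.swap) (simp add: sum_distrib_left[symmetric] KC(4) Int_def)
  also have "\<dots> \<le> (\<Sum>u\<in>V. w u * (real (card K) - 2 + (\<Sum>i\<in>K. of_bool (u \<in> U i))))"
    using count w(1) by (intro sum_mono mult_left_mono) (auto intro: less_imp_le)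
  also have "\<dots> = (real (card K) - 2) + (\<Sum>u\<in>V. \<Sum>i\<in>K. w u * of_bool (u \<in> U i))"
    by (simp add: distrib_left sum.distrib sum_distrib_right[symmetric] w(2) sum_distrib_left)
  also have "(\<Sum>u\<in>V. \<Sum>i\<in>K. w u * of_bool (u \<in> U i)) = (\<Sum>i\<in>K. sum w (U i))"
    by (subst sum.swap, rule sum.cong[OF refl], rule sum.mono_neutral_cong_right)
      (use V(1) in \<open>auto simp: U_def\<close>)
  finally have "(\<Sum>i\<in>K. d i) \<le> real (card K) - 2 + (\<Sum>i\<in>K. sum w (U i))" .
  moreover have "(\<Sum>i\<in>K. 2 * \<phi>) \<le> (\<Sum>i\<in>K. d i + 1 - sum w (U i))"
    by (intro sum_mono main)
  \<comment> \<open>The weights of the sets \<open>U i\<close> cancel between the two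
    estimates.\<close>
  ultimately have "2 * real (card K) * \<phi> \<le> 2 * real (card K) - 2"
    by (simp add: sum.distrib sum_subtractf)
  hence "\<phi> \<le> 1 - 1 / real (card K)" using \<open>card K \<ge> 1\<close> by (simp add: field_simps)
  thus ?thesis using KC Kne by blast
qed

section \<open>Stationarity of the weighted edge form\<close>

text \<open>Here \<open>g (u, k)\<close> is coordinate \<open>k\<close> of a vector in dimension
  \<open>d\<close> attached to \<open>u\<close>. Positive semidefiniteness is thus built in, and
  rescaling a single vector is an admissible variation.\<close>

definition gram :: "nat \<Rightarrow> ('a \<times> nat \<Rightarrow> real) \<Rightarrow> 'a \<Rightarrow> 'a \<Rightarrow> real" where
  "gram d g u v = (\<Sum>k<d. g (u, k) * g (v, k))"

text \<open>The squared Frobenius norm of the Gram matrix on \<open>V\<close>, hence of degree four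
  in \<open>g\<close>.\<close>

definition gram_norm2 :: "nat \<Rightarrow> 'a set \<Rightarrow> ('a \<times> nat \<Rightarrow> real) \<Rightarrow> real" where
  "gram_norm2 d V g = (\<Sum>u\<in>V. \<Sum>v\<in>V. (gram d g u v)\<^sup>2)"

text \<open>Each edge is counted in both orders, so the constant \<open>y = 1\<close> gives the
  trace inner product of the adjacency and Gram matrices.\<close>

definition edge_form ::
  "nat \<Rightarrow> 'a set \<Rightarrow> 'a set set \<Rightarrow> ('a \<Rightarrow> real) \<Rightarrow> ('a \<times> nat \<Rightarrow> real) \<Rightarrow> real" where
  "edge_form d V E y g =
     (\<Sum>u\<in>V. \<Sum>v\<in>V. of_bool ({u, v} \<in> E) * (y u * y v) * gram d g u v)"

lemma gram_commute: "gram d g u v = gram d g v u"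
  by (simp add: gram_def mult.commute)

text \<open>The square of an inner product is the inner product of the tensor squares, so the double
  sum is an inner product of the second-moment matrices of \<open>S\<close> and
  \<open>T\<close>.\<close>

lemma sum_gram_squares:
  "(\<Sum>u\<in>S. \<Sum>v\<in>T. (gram d g u v)\<^sup>2) =
   (\<Sum>(k, l) \<in> {..<d} \<times> {..<d}. (\<Sum>u\<in>S. g (u, k) * g (u, l)) * (\<Sum>v\<in>T. g (v, k) * g (v, l)))"
proof -
  have "(\<Sum>u\<in>S. \<Sum>v\<in>T. (gram d g u v)\<^sup>2) =
    (\<Sum>u\<in>S. \<Sum>v\<in>T. \<Sum>(k, l) \<in> {..<d} \<times> {..<d}. (g (u, k) * g (u, l)) * (g (v, k) * g (v, l)))"
    by (simp add: gram_def power2_eq_square sum_product sum.cartesian_product case_prod_unfold mult_ac)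
  also have "\<dots> = (\<Sum>(k, l) \<in> {..<d} \<times> {..<d}. \<Sum>u\<in>S. \<Sum>v\<in>T. (g (u, k) * g (u, l)) * (g (v, k) * g (v, l)))"
    by (subst sum.swap[of _ "{..<d} \<times> {..<d}" T], subst sum.swap[of _ "{..<d} \<times> {..<d}" S])
      (simp add: case_prod_unfold)
  also have "\<dots> = (\<Sum>(k, l) \<in> {..<d} \<times> {..<d}. (\<Sum>u\<in>S. g (u, k) * g (u, l)) * (\<Sum>v\<in>T. g (v, k) * g (v, l)))"
    by (simp add: sum_product)
  finally show ?thesis .
qed

text \<open>Cauchy-Schwarz for the two second-moment matrices. With \<open>T = V\<close> it bounds
  the norm of the block on \<open>S\<close> from below.\<close>

lemma sum_gram_squares_Cauchy_Schwarz:
  "(\<Sum>u\<in>S. \<Sum>v\<in>T. (gram d g u v)\<^sup>2)\<^sup>2 \<le> gram_norm2 d S g * gram_norm2 d T g"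
  unfolding gram_norm2_def sum_gram_squares
  using Cauchy_Schwarz_ineq_sum[of "\<lambda>(k, l). \<Sum>u\<in>S. g (u, k) * g (u, l)"
      "\<lambda>(k, l). \<Sum>u\<in>T. g (u, k) * g (u, l)" "{..<d} \<times> {..<d}"]
  by (simp add: case_prod_unfold power2_eq_square)

text \<open>A diagonal Gram entry is a sum of squares of coordinates and is itself bounded by the
  norm. This confines the maximization to a box.\<close>

lemma entry_le_1_of_gram_norm2_le_1:
  assumes "finite V" "gram_norm2 d V g \<le> 1" "u \<in> V" "k < d"
  shows "\<bar>g (u, k)\<bar> \<le> 1"
proof -
  have "(gram d g u u)\<^sup>2 \<le> (\<Sum>v\<in>V. (gram d g u v)\<^sup>2)"
    by (rule member_le_sum) (use assms in auto)
  also have "\<dots> \<le> gram_norm2 d V g"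
    unfolding gram_norm2_def by (rule member_le_sum) (use assms in \<open>auto intro: sum_nonneg\<close>)
  finally have "(gram d g u u)\<^sup>2 \<le> 1\<^sup>2" using assms by simp
  hence "gram d g u u \<le> 1" by (rule power2_le_imp_le) simp
  moreover have "(g (u, k))\<^sup>2 \<le> gram d g u u"
    unfolding gram_def power2_eq_square by (rule member_le_sum) (use assms in auto)
  ultimately have "(g (u, k))\<^sup>2 \<le> 1" by simp
  thus ?thesis by (simp add: abs_square_le_1)
qed

lemma edge_form_cong:
  assumes "\<And>u. u \<in> V \<Longrightarrow> y u = y' u" "\<And>u k. u \<in> V \<Longrightarrow> k < d \<Longrightarrow> g (u, k) = g' (u, k)"
  shows "edge_form d V E y g = edge_form d V E y' g'"
  unfolding edge_form_def gram_def using assms by (intro sum.cong) auto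

lemma gram_norm2_cong:
  assumes "\<And>u k. u \<in> V \<Longrightarrow> k < d \<Longrightarrow> g (u, k) = g' (u, k)"
  shows "gram_norm2 d V g = gram_norm2 d V g'"
  unfolding gram_norm2_def gram_def using assms by (intro sum.cong arg_cong[of _ _ "\<lambda>x. x\<^sup>2"]) auto

section \<open>Compactness and existence of a maximizer\<close>

text \<open>Tychonoff's theorem for the product topology on functions, with a factor set that may
  depend on the index.\<close>

lemma compact_coordinatewise:
  fixes B :: "'i \<Rightarrow> real set"
  assumes "\<And>i. compact (B i)"
  shows "compact {f. \<forall>i. f i \<in> B i}"
proof -
  have "compactin (product_topology (\<lambda>i. euclidean) UNIV) (PiE UNIV B)"
    using assms by (subst compactin_PiE) auto
  moreover have "PiE UNIV B = {f. \<forall>i. f i \<in> B i}" by auto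
  ultimately show ?thesis by (simp add: euclidean_product_topology)
qed

text \<open>A continuous function on a nonempty compact set. With constraints stated as inequalities
  the zero pair is feasible, even for \<open>d = 0\<close>.\<close>

lemma edge_form_attains_max:
  fixes V :: "'a set"
  assumes "finite V"
  obtains y g where "(\<Sum>u\<in>V. (y u)\<^sup>2) \<le> 1" "gram_norm2 d V g \<le> 1"
    "\<And>y' g'. \<lbrakk>(\<Sum>u\<in>V. (y' u)\<^sup>2) \<le> 1; gram_norm2 d V g' \<le> 1\<rbrakk> \<Longrightarrow>
       edge_form d V E y' g' \<le> edge_form d V E y g"
proof -
  \<comment> \<open>Coordinates outside \<open>V\<close> are pinned to 0; a competitor is later
    truncated in the same way, which changes neither the form nor the constraints.\<close>
  define Y where "Y = {y :: 'a \<Rightarrow> real. \<forall>u. y u \<in> (if u \<in> V then {-1..1} else {0})}"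
  define G where "G = {g :: 'a \<times> nat \<Rightarrow> real. \<forall>p. g p \<in> (if p \<in> V \<times> {..<d} then {-1..1} else {0})}"
  define C where "C = (Y \<times> G) \<inter>
    {p. (\<Sum>u\<in>V. (fst p u)\<^sup>2) \<le> 1} \<inter> {p. gram_norm2 d V (snd p) \<le> 1}"
  have [continuous_intros]: "continuous_on UNIV (\<lambda>p::('a \<Rightarrow> real) \<times> ('a \<times> nat \<Rightarrow> real). fst p u)" for u
    by (rule continuous_on_product_then_coordinatewise) (intro continuous_intros)
  have [continuous_intros]: "continuous_on UNIV (\<lambda>p::('a \<Rightarrow> real) \<times> ('a \<times> nat \<Rightarrow> real). snd p u)" for u
    by (rule continuous_on_product_then_coordinatewise) (intro continuous_intros)
  have "compact (Y \<times> G)"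
    unfolding Y_def G_def by (intro compact_Times compact_coordinatewise) auto
  moreover have "closed {p::('a \<Rightarrow> real) \<times> ('a \<times> nat \<Rightarrow> real). (\<Sum>u\<in>V. (fst p u)\<^sup>2) \<le> 1}"
    by (intro closed_Collect_le continuous_intros)
  moreover have "closed {p::('a \<Rightarrow> real) \<times> ('a \<times> nat \<Rightarrow> real). gram_norm2 d V (snd p) \<le> 1}"
    unfolding gram_norm2_def gram_def by (intro closed_Collect_le continuous_intros)
  ultimately have "compact C" unfolding C_def by (intro compact_Int_closed)
  moreover have "(\<lambda>_. 0, \<lambda>_. 0) \<in> C"
    by (auto simp: C_def Y_def G_def gram_norm2_def gram_def)
  hence "C \<noteq> {}" by blast
  moreover have "continuous_on UNIV (\<lambda>p. edge_form d V E (fst p) (snd p))"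
    unfolding edge_form_def gram_def by (intro continuous_intros)
  hence "continuous_on C (\<lambda>p. edge_form d V E (fst p) (snd p))"
    by (rule continuous_on_subset) simp
  ultimately obtain p where p: "p \<in> C"
    and max: "\<And>q. q \<in> C \<Longrightarrow> edge_form d V E (fst q) (snd q) \<le> edge_form d V E (fst p) (snd p)"
    using continuous_attains_sup[of C "\<lambda>p. edge_form d V E (fst p) (snd p)"] by blast
  show ?thesis
  proof (rule that[of "fst p" "snd p"])
    show "(\<Sum>u\<in>V. (fst p u)\<^sup>2) \<le> 1" "gram_norm2 d V (snd p) \<le> 1" using p by (auto simp: C_def)
    fix y' :: "'a \<Rightarrow> real" and g' :: "'a \<times> nat \<Rightarrow> real"
    assume y': "(\<Sum>u\<in>V. (y' u)\<^sup>2) \<le> 1" and g': "gram_norm2 d V g' \<le> 1"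
    define y where "y = (\<lambda>u. if u \<in> V then y' u else 0)"
    define g where "g = (\<lambda>p. if p \<in> V \<times> {..<d} then g' p else 0)"
    have "\<bar>y' u\<bar> \<le> 1" if "u \<in> V" for u
    proof -
      have "(y' u)\<^sup>2 \<le> (\<Sum>u\<in>V. (y' u)\<^sup>2)" by (rule member_le_sum) (use that assms in auto)
      hence "(y' u)\<^sup>2 \<le> 1" using y' by linarith
      thus ?thesis by (simp add: abs_square_le_1)
    qed
    hence "y \<in> Y" by (auto simp: y_def Y_def abs_le_iff minus_le_iff)
    moreover have "g \<in> G"
      using entry_le_1_of_gram_norm2_le_1[OF assms g']
      by (auto simp: g_def G_def abs_le_iff minus_le_iff)
    moreover have "(\<Sum>u\<in>V. (y u)\<^sup>2) \<le> 1" using y' by (simp add: y_def)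
    moreover have "gram_norm2 d V g = gram_norm2 d V g'"
      by (rule gram_norm2_cong) (auto simp: g_def)
    hence "gram_norm2 d V g \<le> 1" using g' by simp
    ultimately have "(y, g) \<in> C" by (simp add: C_def)
    from max[OF this] have "edge_form d V E y g \<le> edge_form d V E (fst p) (snd p)" by simp
    moreover have "edge_form d V E y g = edge_form d V E y' g'"
      by (rule edge_form_cong) (auto simp: y_def g_def)
    ultimately show "edge_form d V E y' g' \<le> edge_form d V E (fst p) (snd p)" by simp
  qed
qed

section \<open>Homogeneity of the edge form\<close>

lemma edge_form_scale: "edge_form d V E (\<lambda>u. s * y u) (\<lambda>p. t * g p) = s\<^sup>2 * t\<^sup>2 * edge_form d V E y g"
  unfolding edge_form_def gram_def sum_distrib_left by (simp add: power2_eq_square mult_ac)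

lemma gram_norm2_scale: "gram_norm2 d V (\<lambda>p. t * g p) = t ^ 4 * gram_norm2 d V g"
proof -
  have "gram d (\<lambda>p. t * g p) u v = t\<^sup>2 * gram d g u v" for u v
    unfolding gram_def sum_distrib_left by (simp add: power2_eq_square mult_ac)
  thus ?thesis by (simp add: gram_norm2_def sum_distrib_left power_mult_distrib)
qed

lemma gram_norm2_nonneg: "gram_norm2 d V g \<ge> 0"
  unfolding gram_norm2_def by (intro sum_nonneg) auto

text \<open>Both sides have degree two in \<open>y\<close> and degree two in \<open>g\<close>, so
  normalizing reduces to the assumed bound; if a norm vanishes, so does the form.\<close>

lemma edge_form_le_homogeneous:
  assumes V: "finite V" and \<phi>: "\<phi> \<ge> 0"
    and bound: "\<And>y g. \<lbrakk>(\<Sum>u\<in>V. (y u)\<^sup>2) \<le> 1; gram_norm2 d V g \<le> 1\<rbrakk> \<Longrightarrow> edge_form d V E y g \<le> \<phi>"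
  shows "edge_form d V E y g \<le> \<phi> * (\<Sum>u\<in>V. (y u)\<^sup>2) * sqrt (gram_norm2 d V g)"
proof -
  let ?W = "\<Sum>u\<in>V. (y u)\<^sup>2" and ?Q = "gram_norm2 d V g"
  have W0: "?W \<ge> 0" by (intro sum_nonneg) auto
  have Q0: "?Q \<ge> 0" by (rule gram_norm2_nonneg)
  consider "?W = 0" | "?Q = 0" | "?W > 0" "?Q > 0" using W0 Q0 by linarith
  thus ?thesis
  proof cases
    case 1
    hence "\<forall>u\<in>V. y u = 0" using V by (simp add: sum_nonneg_eq_0_iff)
    hence "edge_form d V E y g = 0" by (simp add: edge_form_def)
    thus ?thesis using 1 by simp
  next
    case 2
    hence "\<forall>u\<in>V. \<forall>v\<in>V. gram d g u v = 0"
      using V by (simp add: gram_norm2_def sum_nonneg_eq_0_iff sum_nonneg)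
    hence "edge_form d V E y g = 0" by (simp add: edge_form_def)
    thus ?thesis using 2 by simp
  next
    case 3
    \<comment> \<open>A fourth root is needed for \<open>t\<close> because \<open>gram_norm2\<close>
      has degree four.\<close>
    define s t where "s = 1 / sqrt ?W" and "t = 1 / sqrt (sqrt ?Q)"
    have s: "s\<^sup>2 * ?W = 1" using 3 by (simp add: s_def power_divide)
    have t2: "t\<^sup>2 = 1 / sqrt ?Q" using 3 by (simp add: t_def power_divide)
    have "t ^ 4 = (t\<^sup>2)\<^sup>2" by simp
    hence t: "t ^ 4 * ?Q = 1" using 3 by (simp add: t2 power_divide)
    have "(\<Sum>u\<in>V. (s * y u)\<^sup>2) = s\<^sup>2 * ?W" by (simp add: power_mult_distrib sum_distrib_left)
    hence "edge_form d V E (\<lambda>u. s * y u) (\<lambda>p. t * g p) \<le> \<phi>"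
      using s t by (intro bound) (simp_all add: gram_norm2_scale)
    hence "s\<^sup>2 * t\<^sup>2 * edge_form d V E y g \<le> \<phi>" by (simp only: edge_form_scale)
    moreover have "s\<^sup>2 = 1 / ?W" using 3 by (simp add: s_def power_divide)
    ultimately have "edge_form d V E y g / (?W * sqrt ?Q) \<le> \<phi>" by (simp add: t2)
    thus ?thesis using 3 by (simp add: pos_divide_le_eq mult.assoc)
  qed
qed

section \<open>First-order conditions at a maximizer\<close>

lemma sum_symmetric_add:
  fixes M :: "'a \<Rightarrow> 'a \<Rightarrow> real"
  assumes "\<And>u v. M u v = M v u"
  shows "(\<Sum>u\<in>V. \<Sum>v\<in>V. M u v * (b u + b v)) = 2 * (\<Sum>u\<in>V. b u * (\<Sum>v\<in>V. M u v))"
proof -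
  have "(\<Sum>u\<in>V. \<Sum>v\<in>V. M u v * (b u + b v)) =
    (\<Sum>u\<in>V. \<Sum>v\<in>V. M u v * b u) + (\<Sum>u\<in>V. \<Sum>v\<in>V. M u v * b v)"
    by (simp add: distrib_left sum.distrib)
  also have "(\<Sum>u\<in>V. \<Sum>v\<in>V. M u v * b v) = (\<Sum>u\<in>V. \<Sum>v\<in>V. M u v * b u)"
    by (subst sum.swap) (simp add: assms)
  finally show ?thesis by (simp add: sum_distrib_left mult.commute)
qed

text \<open>The homogeneous inequality holds for all pairs and is an equality at \<open>y\<close>,
  \<open>g\<close>. Free one-parameter variations therefore suffice, without Lagrange
  multipliers.\<close>

lemma edge_form_maximizer_stationary:
  fixes V :: "'a set"
  assumes V: "finite V" and \<phi>: "\<phi> > 0"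
    and W: "(\<Sum>u\<in>V. (y u)\<^sup>2) = 1" and Q: "gram_norm2 d V g = 1"
    and max: "edge_form d V E y g = \<phi>"
      "\<And>y g. edge_form d V E y g \<le> \<phi> * (\<Sum>u\<in>V. (y u)\<^sup>2) * sqrt (gram_norm2 d V g)"
    and u: "u \<in> V"
  shows "(\<Sum>v\<in>V. of_bool ({u, v} \<in> E) * y v * gram d g u v) = \<phi> * y u"
    and "(\<Sum>v\<in>V. (gram d g u v)\<^sup>2) = (y u)\<^sup>2"
proof -
  let ?a = "\<lambda>u v. of_bool ({u, v} \<in> E) :: real"
  define b where "b = (\<lambda>v. of_bool (v = u) :: real)"
  have delta: "(\<Sum>v\<in>V. b v * f v) = f u" for f
    using V u by (simp add: b_def)
  have sym: "?a v z = ?a z v" for v z by (simp add: insert_commute)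
  \<comment> \<open>The Gram vectors stay fixed and only the value at \<open>u\<close> varies; the
    homogeneous bound says that \<open>F\<close> attains its maximum 0 at 0.\<close>
  define F where "F = (\<lambda>t. edge_form d V E (\<lambda>v. y v + t * b v) g - \<phi> * (\<Sum>v\<in>V. (y v + t * b v)\<^sup>2))"
  have F0: "F t \<le> F 0" for t
    using max(2)[of "\<lambda>v. y v + t * b v" g] by (simp add: F_def Q max(1) W)
  have "DERIV F 0 :> (\<Sum>v\<in>V. \<Sum>z\<in>V. ?a v z * (b v * y z + y v * b z) * gram d g v z)
      - \<phi> * (\<Sum>v\<in>V. 2 * y v * b v)"
    unfolding F_def edge_form_def
    by (auto intro!: derivative_eq_intros sum.cong simp: algebra_simps)
  hence "(\<Sum>v\<in>V. \<Sum>z\<in>V. ?a v z * (b v * y z + y v * b z) * gram d g v z) = \<phi> * (\<Sum>v\<in>V. 2 * y v * b v)"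
    using DERIV_local_max[of F _ 0 1] F0 by fastforce
  also have "(\<Sum>v\<in>V. \<Sum>z\<in>V. ?a v z * (b v * y z + y v * b z) * gram d g v z) =
    (\<Sum>v\<in>V. \<Sum>z\<in>V. b v * (?a v z * y z * gram d g v z)) + (\<Sum>v\<in>V. \<Sum>z\<in>V. b z * (?a v z * y v * gram d g v z))"
    by (simp add: algebra_simps sum.distrib)
  also have "(\<Sum>v\<in>V. \<Sum>z\<in>V. b z * (?a v z * y v * gram d g v z)) = (\<Sum>v\<in>V. \<Sum>z\<in>V. b v * (?a v z * y z * gram d g v z))"
    by (subst sum.swap) (simp add: sym gram_commute)
  also have "(\<Sum>v\<in>V. \<Sum>z\<in>V. b v * (?a v z * y z * gram d g v z)) = (\<Sum>z\<in>V. ?a u z * y z * gram d g u z)"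
    by (simp add: sum_distrib_left[symmetric] delta)
  also have "(\<Sum>v\<in>V. 2 * y v * b v) = 2 * y u"
    using delta[of "\<lambda>v. 2 * y v"] by (simp add: mult_ac)
  finally show stat: "(\<Sum>v\<in>V. ?a u v * y v * gram d g u v) = \<phi> * y u" by simp

  \<comment> \<open>Only the Gram vector of \<open>u\<close> is rescaled, by the factor 1 +
    t.\<close>
  define h where "h = (\<lambda>t p. (1 + t * b (fst p)) * g p)"
  have gram_h: "gram d (h t) v z = (1 + t * b v) * (1 + t * b z) * gram d g v z" for t v z
    unfolding gram_def h_def sum_distrib_left by (simp add: mult_ac)
  \<comment> \<open>The bound 2 sqrt q \<le> 1 + q, tight at q = 1, replaces the square root, so
    \<open>H\<close> is polynomial in t and still maximal at 0.\<close>
  define H where "H = (\<lambda>t. 2 * edge_form d V E y (h t) - \<phi> * gram_norm2 d V (h t))"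
  have H0: "H t \<le> H 0" for t
  proof -
    have "2 * edge_form d V E y (h t) \<le> 2 * \<phi> * sqrt (gram_norm2 d V (h t))"
      using max(2)[of y "h t"] W by simp
    also have "2 * sqrt (gram_norm2 d V (h t)) \<le> 1 + gram_norm2 d V (h t)"
      using zero_le_power2[of "1 - sqrt (gram_norm2 d V (h t))"] gram_norm2_nonneg[of d V "h t"]
      by (simp add: power2_diff)
    hence "2 * \<phi> * sqrt (gram_norm2 d V (h t)) \<le> \<phi> * (1 + gram_norm2 d V (h t))"
      using \<phi> by simp
    finally have "H t \<le> \<phi>" by (simp add: H_def algebra_simps)
    moreover have "h 0 = g" by (simp add: h_def)
    hence "H 0 = \<phi>" by (simp add: H_def max(1) Q)
    ultimately show ?thesis by simp
  qed
  have "DERIV H 0 :> 2 * (\<Sum>v\<in>V. \<Sum>z\<in>V. (?a v z * (y v * y z) * gram d g v z) * (b v + b z))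
      - \<phi> * (2 * (\<Sum>v\<in>V. \<Sum>z\<in>V. (gram d g v z)\<^sup>2 * (b v + b z)))"
    unfolding H_def edge_form_def gram_norm2_def gram_h sum_distrib_left
    by (auto intro!: derivative_eq_intros sum.cong simp: algebra_simps power2_eq_square)
  hence "2 * (\<Sum>v\<in>V. \<Sum>z\<in>V. (?a v z * (y v * y z) * gram d g v z) * (b v + b z)) =
      \<phi> * (2 * (\<Sum>v\<in>V. \<Sum>z\<in>V. (gram d g v z)\<^sup>2 * (b v + b z)))"
    using DERIV_local_max[of H _ 0 1] H0 by fastforce
  also have "(\<Sum>v\<in>V. \<Sum>z\<in>V. (gram d g v z)\<^sup>2 * (b v + b z)) = 2 * (\<Sum>z\<in>V. (gram d g u z)\<^sup>2)"
    by (subst sum_symmetric_add) (simp_all add: delta gram_commute)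
  also have "(\<Sum>v\<in>V. \<Sum>z\<in>V. (?a v z * (y v * y z) * gram d g v z) * (b v + b z)) =
      2 * (\<Sum>z\<in>V. ?a u z * (y u * y z) * gram d g u z)"
    by (subst sum_symmetric_add) (simp_all add: delta sym gram_commute mult.commute)
  also have "(\<Sum>z\<in>V. ?a u z * (y u * y z) * gram d g u z) = y u * (\<Sum>v\<in>V. ?a u v * y v * gram d g u v)"
    by (simp add: sum_distrib_left mult_ac)
  finally have "y u * (\<phi> * y u) = \<phi> * (\<Sum>z\<in>V. (gram d g u z)\<^sup>2)"
    unfolding stat by simp
  thus "(\<Sum>v\<in>V. (gram d g u v)\<^sup>2) = (y u)\<^sup>2" using \<phi> by (simp add: power2_eq_square)
qed

section \<open>Clique bound for the edge form\<close>

text \<open>The stationarity identities at a maximizer supply the inequality on independent sets for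
  the weights \<open>(y u)\<^sup>2\<close>. The clique is chosen before \<open>y\<close> and
  \<open>g\<close> are quantified.\<close>

theorem edge_form_le_clique:
  fixes V :: "'a set"
  assumes V: "finite V" "V \<noteq> {}" and loopless: "\<And>u. {u} \<notin> E"
  shows "\<exists>K \<subseteq> V. clique K E \<and> K \<noteq> {} \<and> (\<forall>y g.
    edge_form d V E y g \<le> (1 - 1 / real (card K)) * (\<Sum>u\<in>V. (y u)\<^sup>2) * sqrt (gram_norm2 d V g))"
proof -
  let ?a = "\<lambda>u v. of_bool ({u, v} \<in> E) :: real"
  obtain y g where yg: "(\<Sum>u\<in>V. (y u)\<^sup>2) \<le> 1" "gram_norm2 d V g \<le> 1"
    and max: "\<And>y' g'. \<lbrakk>(\<Sum>u\<in>V. (y' u)\<^sup>2) \<le> 1; gram_norm2 d V g' \<le> 1\<rbrakk> \<Longrightarrow>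
       edge_form d V E y' g' \<le> edge_form d V E y g"
    using edge_form_attains_max[OF V(1)] by metis
  define \<phi> where "\<phi> = edge_form d V E y g"
  have \<phi>0: "\<phi> \<ge> 0"
    using max[of "\<lambda>_. 0" "\<lambda>_. 0"] by (simp add: \<phi>_def edge_form_def gram_norm2_def gram_def)
  have hom: "edge_form d V E y g \<le> \<phi> * (\<Sum>u\<in>V. (y u)\<^sup>2) * sqrt (gram_norm2 d V g)" for y g
    using V(1) \<phi>0 max unfolding \<phi>_def by (rule edge_form_le_homogeneous)
  have "\<exists>K \<subseteq> V. clique K E \<and> K \<noteq> {} \<and> \<phi> \<le> 1 - 1 / real (card K)"
  proof (cases "\<phi> = 0")
    case True
    obtain v where "v \<in> V" using V(2) by blast
    \<comment> \<open>A single vertex gives the bound 1 - 1/1 = 0.\<close>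
    thus ?thesis using True by (intro exI[of _ "{v}"]) (auto simp: clique_def)
  next
    case False
    hence \<phi>: "\<phi> > 0" using \<phi>0 by simp
    let ?W = "\<Sum>u\<in>V. (y u)\<^sup>2" and ?Q = "gram_norm2 d V g"
    \<comment> \<open>Both factors are at most 1 while their product is at least 1, so both
      constraints are tight.\<close>
    have "1 \<le> ?W * sqrt ?Q" using hom[of y g] \<phi> by (simp add: \<phi>_def mult.assoc)
    moreover have W0: "?W \<ge> 0" by (intro sum_nonneg) auto
    moreover have sQ: "sqrt ?Q \<le> 1" "sqrt ?Q \<ge> 0" using yg(2) gram_norm2_nonneg[of d V g] by auto
    ultimately have W1: "?W = 1" and "sqrt ?Q = 1"
      using yg(1) mult_left_le[of "sqrt ?Q" ?W] mult_left_le_one_le[of "sqrt ?Q" ?W] by linarith+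
    hence Q1: "?Q = 1" by simp
    note stat = edge_form_maximizer_stationary[OF V(1) \<phi> W1 Q1 \<phi>_def[symmetric] hom]
    define w where "w u = (y u)\<^sup>2" for u
    \<comment> \<open>Restricting to the support makes all weights strictly positive.\<close>
    define V' where "V' = {u \<in> V. y u \<noteq> 0}"
    have V': "finite V'" "V' \<subseteq> V" using V(1) by (auto simp: V'_def)
    have wV': "sum w V' = 1"
      using W1 V(1) by (subst sum.mono_neutral_left[of V V']) (auto simp: V'_def w_def)
    have "\<exists>K \<subseteq> V'. clique K E \<and> K \<noteq> {} \<and> \<phi> \<le> 1 - 1 / real (card K)"
    proof (rule exists_clique_of_independent_set_bound[OF V'(1) _ loopless _ wV'])
      show "V' \<noteq> {}" using wV' by auto
      show "w u > 0" if "u \<in> V'" for u using that by (simp add: w_def V'_def)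
      fix S assume S: "S \<subseteq> V'" "indep S E"
      let ?s = "sum w S" and ?D = "\<Sum>u\<in>S. w u * wdegree w V' E u"
      have SV: "S \<subseteq> V" "finite S" using S(1) V' by (auto intro: finite_subset)
      have aS: "?a u v = 0" if "u \<in> S" "v \<in> S" for u v
        using S(2) that loopless[of u] by (cases "u = v") (auto simp: indep_def)
      have rows: "(\<Sum>u\<in>S. \<Sum>v\<in>V. (gram d g u v)\<^sup>2) = ?s"
        using stat(2) SV by (intro sum.cong) (auto simp: w_def)
      \<comment> \<open>The block on \<open>S\<close> carries norm at least s^2, so at most s - s^2
        is left for the entries between \<open>S\<close> and its complement.\<close>
      have q: "?s\<^sup>2 \<le> gram_norm2 d S g"
        using sum_gram_squares_Cauchy_Schwarz[of d g V S] by (simp add: rows Q1)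
      have off: "(\<Sum>u\<in>S. \<Sum>v\<in>V - S. (gram d g u v)\<^sup>2) = ?s - gram_norm2 d S g"
      proof -
        have "(\<Sum>v\<in>V - S. (gram d g u v)\<^sup>2) = (\<Sum>v\<in>V. (gram d g u v)\<^sup>2) - (\<Sum>v\<in>S. (gram d g u v)\<^sup>2)" for u
          using sum.subset_diff[OF SV(1) V(1), of "\<lambda>v. (gram d g u v)\<^sup>2"] by simp
        thus ?thesis by (simp add: sum_subtractf rows gram_norm2_def)
      qed
      \<comment> \<open>The first stationarity identity, multiplied by \<open>y u\<close> and summed
        over \<open>S\<close>; independence removes the terms inside \<open>S\<close>.\<close>
      have "\<phi> * ?s = (\<Sum>u\<in>S. y u * (\<Sum>v\<in>V. ?a u v * y v * gram d g u v))"
        using stat(1) SV by (simp add: w_def sum_distrib_left power2_eq_square mult_ac subset_iff)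
      also have "\<dots> = (\<Sum>u\<in>S. \<Sum>v\<in>V - S. (?a u v * (y u * y v)) * gram d g u v)"
        unfolding sum_distrib_left
        by (rule sum.cong[OF refl], rule sum.mono_neutral_cong_right) (use V(1) SV aS in auto)
      also have "\<dots> = (\<Sum>(u, v) \<in> S \<times> (V - S). (?a u v * (y u * y v)) * gram d g u v)"
        by (simp add: sum.cartesian_product)
      finally have "(\<phi> * ?s)\<^sup>2 = (\<Sum>p \<in> S \<times> (V - S).
          (?a (fst p) (snd p) * (y (fst p) * y (snd p))) * gram d g (fst p) (snd p))\<^sup>2"
        by (simp add: case_prod_unfold)
      \<comment> \<open>Cauchy-Schwarz separates the edge weights, which sum to the weighted
        degrees, from the off-block Gram entries.\<close>
      also have "\<dots> \<le> (\<Sum>p \<in> S \<times> (V - S). (?a (fst p) (snd p) * (y (fst p) * y (snd p)))\<^sup>2) *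
          (\<Sum>p \<in> S \<times> (V - S). (gram d g (fst p) (snd p))\<^sup>2)"
        by (rule Cauchy_Schwarz_ineq_sum)
      also have "(\<Sum>p \<in> S \<times> (V - S). (gram d g (fst p) (snd p))\<^sup>2) = ?s - gram_norm2 d S g"
        using off by (simp add: sum.cartesian_product case_prod_unfold)
      also have "(\<Sum>p \<in> S \<times> (V - S). (?a (fst p) (snd p) * (y (fst p) * y (snd p)))\<^sup>2) =
          (\<Sum>u\<in>S. \<Sum>v\<in>V - S. (?a u v * (y u * y v))\<^sup>2)"
        by (simp add: sum.cartesian_product case_prod_unfold)
      also have "\<dots> = ?D"
        unfolding wdegree_def sum_distrib_left
        by (rule sum.cong[OF refl], rule sum.mono_neutral_cong_right)
          (use V(1) V'(2) aS S(1) in \<open>auto simp: w_def V'_def power_mult_distrib\<close>)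
      finally have "(\<phi> * ?s)\<^sup>2 \<le> ?D * (?s - gram_norm2 d S g)" .
      moreover have D0: "?D \<ge> 0"
        by (intro sum_nonneg mult_nonneg_nonneg) (auto simp: w_def wdegree_def sum_nonneg)
      ultimately have "(\<phi> * ?s)\<^sup>2 \<le> ?D * (?s - ?s\<^sup>2)"
        using mult_left_mono[OF diff_left_mono[OF q], of ?D ?s] by linarith
      hence le: "?s * (\<phi>\<^sup>2 * ?s) \<le> ?s * (?D * (1 - ?s))"
        by (simp add: power2_eq_square algebra_simps)
      have "?s \<ge> 0" by (intro sum_nonneg) (simp add: w_def)
      then consider "?s = 0" | "?s > 0" by linarith
      thus "\<phi>\<^sup>2 * ?s \<le> ?D * (1 - ?s)"
        using le D0 by cases auto
    qed
    thus ?thesis using V'(2) by blast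
  qed
  then obtain K where K: "K \<subseteq> V" "clique K E" "K \<noteq> {}" "\<phi> \<le> 1 - 1 / real (card K)" by blast
  have "edge_form d V E y g \<le> (1 - 1 / real (card K)) * (\<Sum>u\<in>V. (y u)\<^sup>2) * sqrt (gram_norm2 d V g)" for y g
  proof -
    note hom[of y g]
    also have "\<phi> * (\<Sum>u\<in>V. (y u)\<^sup>2) * sqrt (gram_norm2 d V g) \<le>
        (1 - 1 / real (card K)) * (\<Sum>u\<in>V. (y u)\<^sup>2) * sqrt (gram_norm2 d V g)"
      using K(4) gram_norm2_nonneg by (intro mult_right_mono sum_nonneg) auto
    finally show ?thesis .
  qed
  thus ?thesis using K by blast
qed

section \<open>Spectral decomposition of real symmetric matrices\<close>

lemma real_scalar_prod_self_nonneg: "(v :: real vec) \<bullet> v \<ge> 0"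
  by (auto simp: scalar_prod_def intro: sum_nonneg)

text \<open>A complex eigenvalue exists, and its Rayleigh quotient shows that it is real.\<close>

lemma real_symmetric_eigenvalue_exists:
  fixes A :: "real mat"
  assumes A: "A \<in> carrier_mat n n" and sym: "transpose_mat A = A" and n: "n > 0"
  shows "\<exists>e. eigenvalue A e"
proof -
  let ?C = "map_mat complex_of_real A"
  have C: "?C \<in> carrier_mat n n" using A by simp
  obtain k where "eigenvalue ?C k"
    using spectrum_non_empty[OF C n] by (auto simp: spectrum_def)
  then obtain x where x: "x \<in> carrier_vec n" "x \<noteq> 0\<^sub>v n" "?C *\<^sub>v x = k \<cdot>\<^sub>v x"
    using C by (auto simp: eigenvalue_def eigenvector_def)
  have symA: "A $$ (i, j) = A $$ (j, i)" if "i < n" "j < n" for i j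
    using arg_cong[OF sym, of "\<lambda>B. B $$ (i, j)"] that A by auto
  define r where "r = (\<Sum>i<n. cnj (x $ i) * x $ i)"
  have row: "(\<Sum>j<n. complex_of_real (A $$ (i, j)) * x $ j) = k * x $ i" if "i < n" for i
    using arg_cong[OF x(3), of "\<lambda>v. v $ i"] that A x(1)
    by (simp add: scalar_prod_def lessThan_atLeast0)
  \<comment> \<open>The Hermitian form of the eigenvector equals \<open>k * r\<close> and, by
    symmetry of \<open>A\<close>, its own conjugate.\<close>
  define q where "q = (\<Sum>i<n. \<Sum>j<n. cnj (x $ i) * complex_of_real (A $$ (i, j)) * x $ j)"
  have "q = (\<Sum>i<n. cnj (x $ i) * (k * x $ i))"
    unfolding q_def by (intro sum.cong refl) (simp add: row[symmetric] sum_distrib_left mult.assoc)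
  hence qk: "q = k * r" by (simp add: r_def sum_distrib_left mult_ac)
  have "cnj q = (\<Sum>i<n. \<Sum>j<n. x $ i * complex_of_real (A $$ (i, j)) * cnj (x $ j))"
    by (simp add: q_def)
  also have "\<dots> = q"
    unfolding q_def by (subst sum.swap) (intro sum.cong refl, simp add: symA mult_ac)
  finally have "q \<in> \<real>" by (simp add: Reals_cnj_iff)
  moreover have rr: "r = complex_of_real (\<Sum>i<n. (cmod (x $ i))\<^sup>2)"
    unfolding r_def by (simp add: complex_norm_square mult.commute del: of_real_power flip: of_real_power)
  moreover have "r \<noteq> 0"
  proof
    assume "r = 0"
    hence "(\<Sum>i<n. (cmod (x $ i))\<^sup>2) = 0" unfolding rr of_real_eq_0_iff .
    hence "\<forall>i<n. x $ i = 0" by (simp add: sum_nonneg_eq_0_iff)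
    hence "x = 0\<^sub>v n" using x(1) by (intro eq_vecI) auto
    thus False using x(2) by simp
  qed
  ultimately have "q / r \<in> \<real>" by (intro Reals_divide) auto
  hence "k \<in> \<real>" using qk \<open>r \<noteq> 0\<close> by simp
  then obtain e where e: "k = complex_of_real e" by (auto elim: Reals_cases)
  have "poly (char_poly ?C) k = 0"
    using \<open>eigenvalue ?C k\<close> eigenvalue_root_char_poly[OF C] by simp
  hence "poly (char_poly A) e = 0"
    by (simp add: of_real_hom.char_poly_hom[OF A] e)
  thus ?thesis using eigenvalue_root_char_poly[OF A] by blast
qed

text \<open>Complete \<open>v\<close> to a basis, orthogonalize by Gram-Schmidt, which keeps the
  first vector, and normalize the columns; \<open>v\<close> already has length 1.\<close>

lemma orthogonal_matrix_with_first_column: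
  fixes v :: "real vec"
  assumes v: "v \<in> carrier_vec n" and unit: "v \<bullet> v = 1" and n: "n > 0"
  obtains W where "W \<in> carrier_mat n n" "transpose_mat W * W = 1\<^sub>m n" "col W 0 = v"
proof -
  interpret cof_vec_space n "TYPE(real)" .
  have v0: "v \<noteq> 0\<^sub>v n" using unit v by auto
  define ws where "ws = gram_schmidt n (basis_completion v)"
  note bc = basis_completion[OF v v0]
  from gram_schmidt_result[OF bc(2,4,5) ws_def]
  have ws: "corthogonal ws" "set ws \<subseteq> carrier_vec n" "length ws = n" by (auto simp: bc(6))
  obtain vs where "basis_completion v = v # vs"
    using bc(6,7) n by (cases "basis_completion v") auto
  hence "hd ws = v" unfolding ws_def using v by simp
  hence ws0: "ws ! 0 = v" using ws(3) n by (cases ws) auto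
  have wsc: "ws ! i \<in> carrier_vec n" if "i < n" for i using ws that by auto
  have orth: "ws ! i \<bullet> ws ! j = 0 \<longleftrightarrow> i \<noteq> j" if "i < n" "j < n" for i j
    using corthogonalD[OF ws(1)] that ws(3) by simp
  define c where "c i = sqrt (ws ! i \<bullet> ws ! i)" for i
  have c: "c i \<noteq> 0" "c i * c i = ws ! i \<bullet> ws ! i" if "i < n" for i
    using orth[OF that that] real_scalar_prod_self_nonneg[of "ws ! i"] by (auto simp: c_def)
  define W where "W = mat n n (\<lambda>(i, j). ws ! j $ i / c j)"
  have W: "W \<in> carrier_mat n n" by (simp add: W_def)
  have "transpose_mat W * W = 1\<^sub>m n"
  proof (rule eq_matI)
    fix i j assume "i < dim_row (1\<^sub>m n :: real mat)" "j < dim_col (1\<^sub>m n :: real mat)"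
    hence ij: "i < n" "j < n" by auto
    have "(transpose_mat W * W) $$ (i, j) = (\<Sum>k<n. (ws ! i $ k / c i) * (ws ! j $ k / c j))"
      using ij by (simp add: W_def scalar_prod_def lessThan_atLeast0)
    also have "\<dots> = (ws ! i \<bullet> ws ! j) / (c i * c j)"
      using wsc[OF ij(2)] by (simp add: scalar_prod_def lessThan_atLeast0 sum_divide_distrib)
    also have "\<dots> = 1\<^sub>m n $$ (i, j)"
      using ij orth[OF ij] c by auto
    finally show "(transpose_mat W * W) $$ (i, j) = 1\<^sub>m n $$ (i, j)" .
  qed (auto simp: W_def)
  moreover have "col W 0 = v"
    using v n unit by (intro eq_vecI) (auto simp: W_def ws0 c_def)
  ultimately show ?thesis using that W by blast
qed

lemma symmetric_congruence:
  fixes A :: "'a :: comm_semiring_1 mat"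
  assumes "A \<in> carrier_mat n n" "W \<in> carrier_mat n m" "transpose_mat A = A"
  shows "transpose_mat (transpose_mat W * A * W) = transpose_mat W * A * W"
proof -
  have "transpose_mat (transpose_mat W * A * W) = transpose_mat W * transpose_mat (transpose_mat W * A)"
    using assms by (intro transpose_mult) auto
  also have "transpose_mat (transpose_mat W * A) = transpose_mat A * transpose_mat (transpose_mat W)"
    using assms by (intro transpose_mult) auto
  finally show ?thesis using assms by (simp add: assoc_mult_mat[of _ m n _ n _ m])
qed

text \<open>Deflation: after a change to an orthonormal basis starting with an eigenvector, the
  first column is diagonal, by symmetry so is the first row, and induction handles the remaining
  block.\<close>

theorem real_symmetric_orthogonal_diagonalization:
  fixes A :: "real mat"
  assumes "A \<in> carrier_mat n n" "transpose_mat A = A"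
  shows "\<exists>W B. W \<in> carrier_mat n n \<and> B \<in> carrier_mat n n \<and> transpose_mat W * W = 1\<^sub>m n \<and>
    diagonal_mat B \<and> A = W * B * transpose_mat W"
  using assms
proof (induction n arbitrary: A)
  case 0
  thus ?case by (intro exI[of _ "1\<^sub>m 0"] exI[of _ A]) (auto simp: diagonal_mat_def)
next
  case (Suc m)
  let ?n = "Suc m"
  note A = Suc.prems(1)
  obtain e x where x: "x \<in> carrier_vec ?n" "x \<noteq> 0\<^sub>v ?n" "A *\<^sub>v x = e \<cdot>\<^sub>v x"
    using real_symmetric_eigenvalue_exists[OF Suc.prems] A by (auto simp: eigenvalue_def eigenvector_def)
  have xx: "x \<bullet> x > 0"
    using real_scalar_prod_self_nonneg[of x] conjugate_square_eq_0_vec[OF x(1)] x(2) by simp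
  define v where "v = (1 / sqrt (x \<bullet> x)) \<cdot>\<^sub>v x"
  have v: "v \<in> carrier_vec ?n" "A *\<^sub>v v = e \<cdot>\<^sub>v v"
    using x A by (auto simp: v_def mult_mat_vec smult_smult_assoc mult.commute)
  have vv: "v \<bullet> v = 1" using xx x(1) by (simp add: v_def real_sqrt_mult_self flip: power2_eq_square)
  obtain W where W: "W \<in> carrier_mat ?n ?n" and WW: "transpose_mat W * W = 1\<^sub>m ?n" and W0: "col W 0 = v"
    using orthogonal_matrix_with_first_column[OF v(1) vv] by auto
  have WW': "W * transpose_mat W = 1\<^sub>m ?n"
    using mat_mult_left_right_inverse[OF _ W WW] W by simp
  define A' where "A' = transpose_mat W * A * W"
  have A': "A' \<in> carrier_mat ?n ?n" using W A by (simp add: A'_def)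
  have symA': "transpose_mat A' = A'"
    unfolding A'_def by (rule symmetric_congruence[OF A W Suc.prems(2)])
  have A'ji: "A' $$ (j, i) = A' $$ (i, j)" if "i < ?n" "j < ?n" for i j
    using arg_cong[OF symA', of "\<lambda>B. B $$ (i, j)"] that A' by auto
  have A'0: "A' $$ (i, 0) = (if i = 0 then e else 0)" if i: "i < ?n" for i
  proof -
    have "A' = transpose_mat W * (A * W)"
      unfolding A'_def using W A by (intro assoc_mult_mat) auto
    hence "A' $$ (i, 0) = row (transpose_mat W) i \<bullet> col (A * W) 0"
      using i W A by simp
    also have "col (A * W) 0 = A *\<^sub>v v"
      using W A W0 by (auto intro!: eq_vecI)
    also have "row (transpose_mat W) i \<bullet> (A *\<^sub>v v) = e * (row (transpose_mat W) i \<bullet> col W 0)"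
      using v W W0 i by simp
    also have "row (transpose_mat W) i \<bullet> col W 0 = (transpose_mat W * W) $$ (i, 0)"
      using W i by simp
    finally show ?thesis using i by (simp add: WW)
  qed
  define A3 where "A3 = mat m m (\<lambda>(i, j). A' $$ (Suc i, Suc j))"
  have A3: "A3 \<in> carrier_mat m m" by (simp add: A3_def)
  have "transpose_mat A3 = A3" unfolding A3_def using A'ji by (intro eq_matI) auto
  from Suc.IH[OF A3 this] obtain P B where P: "P \<in> carrier_mat m m" and B: "B \<in> carrier_mat m m"
    and PP: "transpose_mat P * P = 1\<^sub>m m" and dB: "diagonal_mat B"
    and A3P: "A3 = P * B * transpose_mat P" by blast
  let ?e = "mat 1 1 (\<lambda>_. e)"
  define P' where "P' = four_block_mat (1\<^sub>m 1) (0\<^sub>m 1 m) (0\<^sub>m m 1) P"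
  define B' where "B' = four_block_mat ?e (0\<^sub>m 1 m) (0\<^sub>m m 1) B"
  have tP': "transpose_mat P' = four_block_mat (1\<^sub>m 1) (0\<^sub>m 1 m) (0\<^sub>m m 1) (transpose_mat P)"
    unfolding P'_def using P by (subst transpose_four_block_mat[of _ 1 1 _ m _ m]) auto
  have P': "P' \<in> carrier_mat ?n ?n" and B': "B' \<in> carrier_mat ?n ?n"
    using P B by (auto simp: P'_def B'_def)
  have A'eq: "A' = four_block_mat ?e (0\<^sub>m 1 m) (0\<^sub>m m 1) A3"
    using A' A'0 A'ji[of _ 0] by (intro eq_matI) (auto simp: A3_def)
  have "P' * B' = four_block_mat ?e (0\<^sub>m 1 m) (0\<^sub>m m 1) (P * B)"
    unfolding P'_def B'_def using P B
    by (subst mult_four_block_mat[of _ 1 1 _ m _ m _ _ 1 _ m]) auto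
  hence "P' * B' * transpose_mat P' = four_block_mat ?e (0\<^sub>m 1 m) (0\<^sub>m m 1) (P * B * transpose_mat P)"
    unfolding tP' using P B
    by (simp add: mult_four_block_mat[of _ 1 1 _ m _ m _ _ 1 _ m])
  hence A'P: "A' = P' * B' * transpose_mat P'" by (simp add: A'eq A3P)
  have "transpose_mat P' * P' = four_block_mat (1\<^sub>m 1) (0\<^sub>m 1 m) (0\<^sub>m m 1) (1\<^sub>m m)"
    unfolding tP' unfolding P'_def using P
    by (subst mult_four_block_mat[of _ 1 1 _ m _ m _ _ 1 _ m]) (auto simp: PP)
  hence P'P': "transpose_mat P' * P' = 1\<^sub>m ?n" by (auto intro!: eq_matI)
  have dB': "diagonal_mat B'"
    using dB B by (auto simp: diagonal_mat_def B'_def)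
  let ?X = "W * P'"
  have tX: "transpose_mat ?X = transpose_mat P' * transpose_mat W"
    using W P' by (rule transpose_mult)
  have "transpose_mat ?X * ?X = transpose_mat P' * (transpose_mat W * W) * P'"
    unfolding tX using W P' by (simp add: assoc_mult_mat[of _ ?n ?n _ ?n _ ?n])
  hence "transpose_mat ?X * ?X = 1\<^sub>m ?n" using WW P'P' P' by simp
  moreover have "?X * B' * transpose_mat ?X = W * A' * transpose_mat W"
    unfolding tX A'P using W P' B' by (simp add: assoc_mult_mat[of _ ?n ?n _ ?n _ ?n])
  moreover have "W * A' * transpose_mat W = (W * transpose_mat W) * A * (W * transpose_mat W)"
    unfolding A'_def using W A by (simp add: assoc_mult_mat[of _ ?n ?n _ ?n _ ?n])
  hence "W * A' * transpose_mat W = A" using WW' A by simp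
  ultimately show ?case
    using W P' B' dB' by (intro exI[of _ ?X] exI[of _ B']) auto
qed

section \<open>Algebraic multiplicities and spectral sums\<close>

lemma order_linear: "Polynomial.order \<mu> [:- a, 1:] = of_bool (a = \<mu>)"
  for a \<mu> :: "'a :: idom"
proof (cases "a = \<mu>")
  case True
  thus ?thesis using order_power_n_n[of a 1] by simp
next
  case False
  thus ?thesis by (simp add: order_0I)
qed

lemma order_prod_linear:
  fixes \<mu> :: "'a :: idom"
  assumes "finite I"
  shows "Polynomial.order \<mu> (\<Prod>k\<in>I. [:- l k, 1:]) = card {k \<in> I. l k = \<mu>}"
  using assms
proof (induction I)
  case (insert k I)
  have eq: "(\<Prod>k\<in>insert k I. [:- l k, 1:]) = [:- l k, 1:] * (\<Prod>k\<in>I. [:- l k, 1:])"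
    using insert.hyps by (rule prod.insert)
  have "(\<Prod>k\<in>insert k I. [:- l k, 1:]) \<noteq> 0"
    using insert.hyps by (subst prod_zero_iff) auto
  hence "Polynomial.order \<mu> (\<Prod>k\<in>insert k I. [:- l k, 1:]) =
      Polynomial.order \<mu> [:- l k, 1:] + Polynomial.order \<mu> (\<Prod>k\<in>I. [:- l k, 1:])"
    unfolding eq by (rule order_mult)
  also have "\<dots> = of_bool (l k = \<mu>) + card {k \<in> I. l k = \<mu>}"
    by (simp only: order_linear insert.IH)
  also have "\<dots> = card {j \<in> insert k I. l j = \<mu>}"
  proof -
    have "{j \<in> insert k I. l j = \<mu>} =
        (if l k = \<mu> then insert k {j \<in> I. l j = \<mu>} else {j \<in> I. l j = \<mu>})" by auto
    thus ?thesis using insert.hyps by simp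
  qed
  finally show ?case .
qed simp

text \<open>Grouping indices by the value of \<open>l\<close> turns multiplicities into repeated
  terms; \<open>max 0\<close> discards the nonpositive ones.\<close>

lemma positive_square_energy_eq_sum:
  assumes A: "A \<in> carrier_mat n n" and cp: "char_poly A = (\<Prod>k<n. [:- l k, 1:])"
  shows "positive_square_energy A = (\<Sum>k<n. (max 0 (l k))\<^sup>2)"
proof -
  let ?I = "{k \<in> {..<n}. l k > 0}"
  have ev: "{\<mu>. eigenvalue A \<mu> \<and> \<mu> > 0} = l ` ?I"
    by (auto simp: eigenvalue_root_char_poly[OF A] cp poly_prod)
  have "positive_square_energy A = (\<Sum>\<mu>\<in>l ` ?I. real (card {k \<in> {..<n}. l k = \<mu>}) * \<mu>\<^sup>2)"
    unfolding positive_square_energy_def ev cp by (simp add: order_prod_linear)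
  also have "\<dots> = (\<Sum>\<mu>\<in>l ` ?I. \<Sum>k\<in>{k \<in> ?I. l k = \<mu>}. (l k)\<^sup>2)"
  proof (rule sum.cong[OF refl])
    fix \<mu> assume "\<mu> \<in> l ` ?I"
    hence "{k \<in> ?I. l k = \<mu>} = {k \<in> {..<n}. l k = \<mu>}" by auto
    thus "real (card {k \<in> {..<n}. l k = \<mu>}) * \<mu>\<^sup>2 = (\<Sum>k\<in>{k \<in> ?I. l k = \<mu>}. (l k)\<^sup>2)" by simp
  qed
  also have "\<dots> = (\<Sum>k\<in>?I. (l k)\<^sup>2)"
    by (rule sum.image_gen[symmetric]) simp
  also have "\<dots> = (\<Sum>k<n. (max 0 (l k))\<^sup>2)"
    by (rule sum.mono_neutral_cong_left) auto
  finally show ?thesis .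
qed

lemma real_symmetric_spectral_decomposition:
  fixes A :: "real mat"
  assumes A: "A \<in> carrier_mat n n" and sym: "transpose_mat A = A"
  obtains l :: "nat \<Rightarrow> real" and v :: "nat \<Rightarrow> nat \<Rightarrow> real" where
    "\<And>k m. \<lbrakk>k < n; m < n\<rbrakk> \<Longrightarrow> (\<Sum>i<n. v k i * v m i) = of_bool (k = m)"
    "\<And>i j. \<lbrakk>i < n; j < n\<rbrakk> \<Longrightarrow> A $$ (i, j) = (\<Sum>k<n. l k * (v k i * v k j))"
    "char_poly A = (\<Prod>k<n. [:- l k, 1:])"
proof -
  obtain W B where W: "W \<in> carrier_mat n n" and B: "B \<in> carrier_mat n n"
    and WW: "transpose_mat W * W = 1\<^sub>m n" and dB: "diagonal_mat B"
    and AW: "A = W * B * transpose_mat W"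
    using real_symmetric_orthogonal_diagonalization[OF assms] by blast
  define l where "l k = B $$ (k, k)" for k
  define v where "v k i = W $$ (i, k)" for k i
  have "(\<Sum>i<n. v k i * v m i) = of_bool (k = m)" if "k < n" "m < n" for k m
    using arg_cong[OF WW, of "\<lambda>M. M $$ (k, m)"] that W
    by (simp add: v_def scalar_prod_def lessThan_atLeast0)
  moreover have "A $$ (i, j) = (\<Sum>k<n. l k * (v k i * v k j))" if ij: "i < n" "j < n" for i j
  proof -
    have WB: "(W * B) $$ (i, k) = W $$ (i, k) * l k" if k: "k < n" for k
    proof -
      have "(W * B) $$ (i, k) = (\<Sum>m<n. W $$ (i, m) * B $$ (m, k))"
        using W B ij k by (simp add: scalar_prod_def lessThan_atLeast0)
      also have "\<dots> = (\<Sum>m<n. if m = k then W $$ (i, k) * l k else 0)"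
        using dB B k by (intro sum.cong) (auto simp: diagonal_mat_def l_def)
      finally show ?thesis using k by simp
    qed
    define M where "M = W * B"
    have "M \<in> carrier_mat n n" using W B by (simp add: M_def)
    hence "A $$ (i, j) = (\<Sum>k<n. M $$ (i, k) * W $$ (j, k))"
      unfolding AW M_def[symmetric] using W ij by (simp add: scalar_prod_def lessThan_atLeast0)
    thus ?thesis by (simp add: M_def WB v_def mult_ac)
  qed
  moreover have "char_poly A = (\<Prod>k<n. [:- l k, 1:])"
  proof -
    have "W * transpose_mat W = 1\<^sub>m n"
      using mat_mult_left_right_inverse[OF _ W WW] W by simp
    hence "similar_mat A B"
      unfolding similar_mat_def using W B A WW AW
      by (intro exI[of _ W] exI[of _ "transpose_mat W"] similar_mat_witI[of _ _ n]) auto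
    hence "char_poly A = char_poly B" by (rule char_poly_similar)
    also have "\<dots> = (\<Prod>a\<leftarrow>diag_mat B. [:- a, 1:])"
      using dB B by (intro char_poly_upper_triangular[OF B]) (auto simp: diagonal_mat_def)
    also have "\<dots> = (\<Prod>k<n. [:- l k, 1:])"
      using B by (simp add: diag_mat_def l_def prod.list_conv_set_nth lessThan_atLeast0)
    finally show ?thesis .
  qed
  ultimately show ?thesis by (rule that)
qed

text \<open>The trace inner product of two matrices diagonal in a common orthonormal basis: the
  rank-one projections are themselves orthonormal.\<close>

lemma sum_spectral_products:
  fixes v :: "nat \<Rightarrow> nat \<Rightarrow> real"
  assumes "\<And>k m. \<lbrakk>k < n; m < n\<rbrakk> \<Longrightarrow> (\<Sum>i<n. v k i * v m i) = of_bool (k = m)"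
  shows "(\<Sum>i<n. \<Sum>j<n. (\<Sum>k<n. a k * (v k i * v k j)) * (\<Sum>m<n. b m * (v m i * v m j))) =
    (\<Sum>k<n. a k * b k)"
proof -
  have "(\<Sum>i<n. \<Sum>j<n. (\<Sum>k<n. a k * (v k i * v k j)) * (\<Sum>m<n. b m * (v m i * v m j))) =
    (\<Sum>i<n. \<Sum>j<n. \<Sum>k<n. \<Sum>m<n. a k * b m * ((v k i * v m i) * (v k j * v m j)))"
    by (simp add: sum_product mult_ac)
  also have "\<dots> = (\<Sum>i<n. \<Sum>k<n. \<Sum>m<n. \<Sum>j<n. a k * b m * ((v k i * v m i) * (v k j * v m j)))"
  proof (rule sum.cong[OF refl])
    fix i
    let ?f = "\<lambda>j k m. a k * b m * ((v k i * v m i) * (v k j * v m j))"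
    have "(\<Sum>j<n. \<Sum>k<n. \<Sum>m<n. ?f j k m) = (\<Sum>k<n. \<Sum>j<n. \<Sum>m<n. ?f j k m)" by (rule sum.swap)
    also have "\<dots> = (\<Sum>k<n. \<Sum>m<n. \<Sum>j<n. ?f j k m)" by (rule sum.cong[OF refl], rule sum.swap)
    finally show "(\<Sum>j<n. \<Sum>k<n. \<Sum>m<n. ?f j k m) = (\<Sum>k<n. \<Sum>m<n. \<Sum>j<n. ?f j k m)" .
  qed
  also have "\<dots> = (\<Sum>k<n. \<Sum>i<n. \<Sum>m<n. \<Sum>j<n. a k * b m * ((v k i * v m i) * (v k j * v m j)))"
    by (rule sum.swap)
  also have "\<dots> = (\<Sum>k<n. \<Sum>m<n. \<Sum>i<n. \<Sum>j<n. a k * b m * ((v k i * v m i) * (v k j * v m j)))"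
    by (rule sum.cong[OF refl], rule sum.swap)
  also have "\<dots> = (\<Sum>k<n. \<Sum>m<n. a k * b m * ((\<Sum>i<n. v k i * v m i) * (\<Sum>j<n. v k j * v m j)))"
    by (simp only: sum_product) (simp only: sum_distrib_left)
  also have "\<dots> = (\<Sum>k<n. \<Sum>m<n. if m = k then a k * b k else 0)"
    by (intro sum.cong refl) (simp add: assms)
  finally show ?thesis by simp
qed

section \<open>The clique bound for the positive square energy\<close>

theorem theorem1p2:
  fixes V :: "'a set" and E :: "'a set set" and vs :: "'a list" and n \<omega> :: nat
  assumes "simple_graph V E"
    and "n = card V" and "n \<ge> 1"
    and "\<omega> = clique_number V E"
    and "distinct vs" and "set vs = V"
  shows "sqrt (positive_square_energy (adjacency_matrix vs E)) \<le> (1 - 1 / real \<omega>) * real n"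
proof -
  define A where "A = adjacency_matrix vs E"
  have V: "finite V" "V \<noteq> {}" using assms(1-3) by (auto simp: simple_graph_def)
  have loopless: "{u} \<notin> E" for u using assms(1) by (auto simp: simple_graph_def nsets_def)
  have n: "length vs = n" using assms(2,5,6) distinct_card by metis
  have A: "A \<in> carrier_mat n n" by (simp add: A_def adjacency_matrix_def n)
  have Aij: "A $$ (i, j) = of_bool ({vs ! i, vs ! j} \<in> E)" if "i < n" "j < n" for i j
    using that by (simp add: A_def adjacency_matrix_def n)
  have sym: "transpose_mat A = A"
    using A by (intro eq_matI) (auto simp: Aij insert_commute)
  obtain l v where
    orth: "\<And>k m. \<lbrakk>k < n; m < n\<rbrakk> \<Longrightarrow> (\<Sum>i<n. v k i * v m i) = of_bool (k = m)" and
    dec: "\<And>i j. \<lbrakk>i < n; j < n\<rbrakk> \<Longrightarrow> A $$ (i, j) = (\<Sum>k<n. l k * (v k i * v k j))" and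
    cp: "char_poly A = (\<Prod>k<n. [:- l k, 1:])"
    by (rule real_symmetric_spectral_decomposition[OF A sym]) (rule that)
  \<comment> \<open>The eigenvalues of the positive part of \<open>A\<close>.\<close>
  define p where "p k = max 0 (l k)" for k
  have energy: "positive_square_energy A = (\<Sum>k<n. p k * p k)"
    using positive_square_energy_eq_sum[OF A cp] by (simp add: p_def power2_eq_square)
  have bij: "bij_betw ((!) vs) {..<n} V"
    using bij_betw_nth[OF assms(5)] n assms(6) by simp
  define pos where "pos = inv_into {..<n} ((!) vs)"
  have pos: "pos (vs ! i) = i" if "i < n" for i
    using bij that by (simp add: pos_def bij_betw_inv_into_left)
  have sumV: "(\<Sum>u\<in>V. f u) = (\<Sum>i<n. f (vs ! i))" for f :: "'a \<Rightarrow> real"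
    using sum.reindex_bij_betw[OF bij, of f] by simp
  \<comment> \<open>Scaling the eigenvector entries by \<open>sqrt (p k)\<close> makes the Gram
    matrix equal to the positive part of \<open>A\<close>.\<close>
  define g where "g = (\<lambda>(u, k). sqrt (p k) * v k (pos u))"
  have gram: "gram n g (vs ! i) (vs ! j) = (\<Sum>k<n. p k * (v k i * v k j))" if "i < n" "j < n" for i j
    unfolding gram_def
  proof (rule sum.cong[OF refl])
    fix k
    have "sqrt (p k) * sqrt (p k) = p k" by (simp add: p_def)
    thus "g (vs ! i, k) * g (vs ! j, k) = p k * (v k i * v k j)"
      using that by (simp add: g_def pos mult_ac)
  qed
  let ?X = "\<lambda>i j. \<Sum>k<n. p k * (v k i * v k j)"
  have "gram_norm2 n V g = (\<Sum>i<n. \<Sum>j<n. ?X i j * ?X i j)"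
    unfolding gram_norm2_def sumV by (intro sum.cong refl) (simp add: gram power2_eq_square)
  also have "\<dots> = positive_square_energy A"
    unfolding energy by (rule sum_spectral_products) (rule orth)
  finally have norm2: "gram_norm2 n V g = positive_square_energy A" .
  have "edge_form n V E (\<lambda>_. 1) g = (\<Sum>i<n. \<Sum>j<n. (\<Sum>k<n. l k * (v k i * v k j)) * ?X i j)"
    unfolding edge_form_def sumV by (intro sum.cong refl) (simp add: gram flip: dec Aij)
  also have "\<dots> = (\<Sum>k<n. l k * p k)"
    by (rule sum_spectral_products) (rule orth)
  \<comment> \<open>Here \<open>l k * p k = p k * p k\<close>, since both vanish when
    \<open>l k\<close> is not positive.\<close>
  also have "\<dots> = positive_square_energy A"
    unfolding energy by (intro sum.cong) (auto simp: p_def max_def)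
  finally have form: "edge_form n V E (\<lambda>_. 1) g = positive_square_energy A" .
  obtain K where K: "K \<subseteq> V" "clique K E" "K \<noteq> {}" and bound: "\<And>y g.
      edge_form n V E y g \<le> (1 - 1 / real (card K)) * (\<Sum>u\<in>V. (y u)\<^sup>2) * sqrt (gram_norm2 n V g)"
    using edge_form_le_clique[OF V loopless, where ?d = n] by blast
  have K1: "card K \<ge> 1" using K(3) finite_subset[OF K(1) V(1)] by (simp add: Suc_le_eq card_gt_0_iff)
  have "card K \<le> \<omega>"
    unfolding assms(4) clique_number_def
  proof (rule Max_ge)
    have "{card K |K. K \<subseteq> V \<and> clique K E} \<subseteq> card ` Pow V" by auto
    thus "finite {card K |K. K \<subseteq> V \<and> clique K E}" using V(1) finite_subset by blast
  qed (use K in auto)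
  hence le: "1 - 1 / real (card K) \<le> 1 - 1 / real \<omega>" using K1 by (simp add: frac_le)
  let ?s = "positive_square_energy A"
  have s0: "?s \<ge> 0" unfolding energy by (intro sum_nonneg) simp
  \<comment> \<open>With constant \<open>y = 1\<close> the weight sum is \<open>n\<close>, and the
    form and the squared norm are both the energy, so one factor \<open>sqrt ?s\<close>
    cancels.\<close>
  have "sqrt ?s * sqrt ?s \<le> ((1 - 1 / real (card K)) * real n) * sqrt ?s"
    using bound[of "\<lambda>_. 1" g] s0 by (simp add: form norm2 flip: assms(2))
  moreover have "(1 - 1 / real (card K)) * real n \<ge> 0" using K1 by simp
  ultimately have "sqrt ?s \<le> (1 - 1 / real (card K)) * real n"
    using s0 by (cases "?s = 0") (auto intro: mult_right_le_imp_le[of _ "sqrt ?s"] simp del: real_sqrt_mult_self)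
  also have "\<dots> \<le> (1 - 1 / real \<omega>) * real n" using le by (intro mult_right_mono) auto
  finally show ?thesis by (simp add: A_def)
qed

end
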